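(* Let $m\ge 1$ be an integer and $0<\theta\le 1$. Let $\mathbf{P}$ be the $(m+1)\times(m+1)$ matrix, with rows and columns indexed by $0,1,\dots,m$, whose only nonzero entries are $$\mathbf{P}_{i,i}=1-\theta\Big(1-\frac{i}{m}\Big)\quad(0\le i\le m),\qquad \mathbf{P}_{i,i+1}=\theta\Big(1-\frac{i}{m}\Big)\quad(0\le i\le m-1).$$ Then $\mathbf{P}$ has eigenvalue matrix $\mathbf{\Lambda}=\mathrm{diag}(\lambda_0,\lambda_1,\dots,\lambda_m)$ with $\lambda_i=1-(1-\tfrac{i}{m})\theta$. An (unscaled) eigenvector matrix $\mathbf{v}$ (whose $j$th column is an eigenvector for $\lambda_j$) and its inverse $\mathbf{w}=\mathbf{v}^{-1}$ have entries, for $0\le i,j\le m$, $$\mathbf{v}_{i,j}=\binom{m-i}{j-i},\qquad \mathbf{w}_{i,j}=(-1)^{i-j}\binom{m-i}{j-i}.$$ The columns of $\mathbf{v}$ (and those of $\mathbf{w}$) are linearly independent, so $\mathbf{P}$ is diagonalisable, with spectral decomposition $\mathbf{P}=\mathbf{v}\mathbf{\Lambda}\mathbf{w}$.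
   Context: Binomial coefficients $\binom{a}{b}$ with $b<0$ or $b>a$ are $0$. All matrix indices start at zero. ($\mathbf{P}$ is the transition matrix of the occupancy-number Markov chain with $m$ bins and occupancy probability $\theta$.) *)

theory Defs
  imports
    "Jordan_Normal_Form.Char_Poly"
    "Jordan_Normal_Form.VS_Connect"
begin

(* Binomial coefficient on integers that vanishes for b < 0 and for b > a.
   Natural-number subtraction truncates, so "(m - i) choose (j - i)" on nat
   would be 1 instead of 0 below the diagonal. *)
definition binom :: "int \<Rightarrow> int \<Rightarrow> real" where
  "binom a b = (if b < 0 \<or> b > a then 0 else real (nat a choose nat b))"

definition occ_mat :: "nat \<Rightarrow> real \<Rightarrow> real mat" where
  "occ_mat m \<theta> = mat (m + 1) (m + 1) (\<lambda>(i, j).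
     if j = i then 1 - \<theta> * (1 - real i / real m)
     else if j = i + 1 then \<theta> * (1 - real i / real m)
     else 0)"

definition occ_eigval :: "nat \<Rightarrow> real \<Rightarrow> nat \<Rightarrow> real" where
  "occ_eigval m \<theta> i = 1 - (1 - real i / real m) * \<theta>"

definition occ_eigval_mat :: "nat \<Rightarrow> real \<Rightarrow> real mat" where
  "occ_eigval_mat m \<theta> = mat_diag (m + 1) (occ_eigval m \<theta>)"

definition occ_eigvec_mat :: "nat \<Rightarrow> real mat" where
  "occ_eigvec_mat m = mat (m + 1) (m + 1) (\<lambda>(i, j).
     binom (int m - int i) (int j - int i))"

definition occ_eigvec_inv_mat :: "nat \<Rightarrow> real mat" where
  "occ_eigvec_inv_mat m = mat (m + 1) (m + 1) (\<lambda>(i, j).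
     (- 1) powi (int i - int j) * binom (int m - int i) (int j - int i))"

(* Linear independence of the columns as an indexed family: the set-based
   notion alone would not exclude repeated columns. *)
definition lin_indpt_cols :: "'a :: field mat \<Rightarrow> bool" where
  "lin_indpt_cols A \<longleftrightarrow> distinct (cols A) \<and>
     \<not> LinearCombinations.module.lin_dep class_ring
         (module_vec TYPE('a) (dim_row A)) (set (cols A))"

definition diagonalisable_mat :: "'a :: field mat \<Rightarrow> bool" where
  "diagonalisable_mat A \<longleftrightarrow> (\<exists>D. diagonal_mat D \<and> similar_mat A D)"

end

theory Submission
  imports Defs
begin

text \<open>
  The absorption identity \<open>(b + 1) C(n, b + 1) = n C(n - 1, b)\<close> gives
  \<open>P v = v \<Lambda>\<close> entrywise. Since \<open>C(n, a) C(n - a, b - a) = C(n, b) C(b, a)\<close>, each entry of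
  \<open>v w\<close> is a multiple of an alternating sum of binomial coefficients, so \<open>v w = 1\<close>; the remaining
  claims are linear algebra, with the eigenvalues read off the upper triangular matrix \<open>P\<close>.
\<close>

text \<open>Both a repeated column and a linear dependence in the set of columns force the
  determinant to be 0; each conjunct of \<open>lin_indpt_cols\<close> excludes one of them.\<close>

lemma lin_indpt_cols_if_det_nonzero:
  fixes A :: "'a :: field mat"
  assumes A: "A \<in> carrier_mat n n" and det: "det A \<noteq> 0"
  shows "lin_indpt_cols A"
proof -
  interpret vec_space "TYPE('a)" n .
  have "distinct (cols A)"
    unfolding distinct_conv_nth
  proof (intro allI impI notI)
    fix i j assume "i < length (cols A)" "j < length (cols A)" "i \<noteq> j" "cols A ! i = cols A ! j"
    then show False
      using det_identical_columns[OF A, of i j] A det by auto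
  qed
  then show ?thesis
    using lin_dep_cols_imp_det_0[OF A] det A unfolding lin_indpt_cols_def by auto
qed

lemma lin_indpt_cols_if_right_inverse:
  fixes A B :: "'a :: field mat"
  assumes A: "A \<in> carrier_mat n n" and B: "B \<in> carrier_mat n n" and "A * B = 1\<^sub>m n"
  shows "lin_indpt_cols A"
proof -
  have "det A * det B = 1"
    using det_mult[OF A B] assms(3) by simp
  then have "det A \<noteq> 0" by auto
  with A show ?thesis by (rule lin_indpt_cols_if_det_nonzero)
qed

lemma mult_diag_mult_inverse:
  fixes A V W :: "'a :: field mat"
  assumes A: "A \<in> carrier_mat n n" and V: "V \<in> carrier_mat n n"
    and D: "D \<in> carrier_mat n n" and W: "W \<in> carrier_mat n n"
    and VW: "V * W = 1\<^sub>m n" and AV: "A * V = V * D"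
  shows "A = V * D * W"
proof -
  have "V * D * W = A * (V * W)"
    using A V W by (simp flip: AV)
  then show ?thesis using A VW by simp
qed

text \<open>Right multiplication by a diagonal matrix scales column j by \<open>d j\<close>, so
  column j of the matrix equation is the eigenvector equation. The diagonal entry certifies that the
  column is not the zero vector.\<close>

lemma eigenvector_col_if_mult_mat_diag:
  fixes A V :: "'a :: comm_ring_1 mat"
  assumes A: "A \<in> carrier_mat n n" and V: "V \<in> carrier_mat n n"
    and AV: "A * V = V * mat_diag n d"
    and j: "j < n" and nz: "V $$ (j, j) \<noteq> 0"
  shows "eigenvector A (col V j) (d j)"
  unfolding eigenvector_def
proof (intro conjI)
  show "col V j \<in> carrier_vec (dim_row A)" using A V by auto
  show "col V j \<noteq> 0\<^sub>v (dim_row A)"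
  proof
    assume "col V j = 0\<^sub>v (dim_row A)"
    then have "col V j $ j = 0" using A j by simp
    then show False using nz V j by simp
  qed
  have "A *\<^sub>v col V j = col (A * V) j"
    using col_mult2[OF A V j] by simp
  also have "\<dots> = d j \<cdot>\<^sub>v col V j"
    unfolding AV mat_diag_mult_right[OF V] using V j by (intro eq_vecI) auto
  finally show "A *\<^sub>v col V j = d j \<cdot>\<^sub>v col V j" .
qed

lemma occ_carrier:
  "occ_mat m \<theta> \<in> carrier_mat (m + 1) (m + 1)"
  "occ_eigvec_mat m \<in> carrier_mat (m + 1) (m + 1)"
  "occ_eigvec_inv_mat m \<in> carrier_mat (m + 1) (m + 1)"
  "occ_eigval_mat m \<theta> \<in> carrier_mat (m + 1) (m + 1)"
  by (simp_all add: occ_mat_def occ_eigvec_mat_def occ_eigvec_inv_mat_def occ_eigval_mat_def)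

lemma occ_dim [simp]:
  "dim_row (occ_mat m \<theta>) = m + 1" "dim_col (occ_mat m \<theta>) = m + 1"
  "dim_row (occ_eigvec_mat m) = m + 1" "dim_col (occ_eigvec_mat m) = m + 1"
  "dim_row (occ_eigvec_inv_mat m) = m + 1" "dim_col (occ_eigvec_inv_mat m) = m + 1"
  by (simp_all add: occ_mat_def occ_eigvec_mat_def occ_eigvec_inv_mat_def)

text \<open>Passes from integer to natural arguments: the cutoff at negative arguments becomes the
  test \<open>i \<le> j\<close>, and \<open>j \<le> m\<close> rules out the cutoff at the
  top.\<close>

lemma binom_diff:
  assumes "i \<le> m" "j \<le> m"
  shows "binom (int m - int i) (int j - int i) = (if i \<le> j then real ((m - i) choose (j - i)) else 0)"
  using assms by (simp add: binom_def nat_diff_distrib)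

lemma occ_eigvec_mat_index:
  assumes "i \<le> m" "j \<le> m"
  shows "occ_eigvec_mat m $$ (i, j) = (if i \<le> j then real ((m - i) choose (j - i)) else 0)"
  using assms by (simp add: occ_eigvec_mat_def binom_diff)

lemma occ_eigvec_inv_mat_index:
  assumes "i \<le> m" "j \<le> m"
  shows "occ_eigvec_inv_mat m $$ (i, j) =
    (if i \<le> j then (- 1) ^ (j - i) * real ((m - i) choose (j - i)) else 0)"
proof -
  \<comment> \<open>The exponent is nonpositive on and above the diagonal; since -1 is its own
    inverse, its sign may be flipped.\<close>
  have "(- 1 :: real) powi (int i - int j) = (- 1) ^ (j - i)" if "i \<le> j"
  proof -
    have "int i - int j = - int (j - i)" using that by simp
    then show ?thesis by (simp only: power_int_minus power_int_of_nat) (simp add: power_inverse[symmetric])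
  qed
  then show ?thesis
    using assms by (simp add: occ_eigvec_inv_mat_def binom_diff)
qed

lemma occ_eigvec_mat_mult_inv:
  "occ_eigvec_mat m * occ_eigvec_inv_mat m = 1\<^sub>m (m + 1)"
proof (rule eq_matI)
  fix i j assume "i < dim_row (1\<^sub>m (m + 1) :: real mat)" "j < dim_col (1\<^sub>m (m + 1) :: real mat)"
  then have ij: "i \<le> m" "j \<le> m" by auto
  let ?f = "\<lambda>k. occ_eigvec_mat m $$ (i, k) * occ_eigvec_inv_mat m $$ (k, j)"
  have "(occ_eigvec_mat m * occ_eigvec_inv_mat m) $$ (i, j) = (\<Sum>k\<in>{0..<m + 1}. ?f k)"
    using ij by (simp add: scalar_prod_def)
  \<comment> \<open>The left factor vanishes for k < i and the right one for k > j. Below the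
    diagonal the range is empty, so the entry is 0.\<close>
  also have "\<dots> = (\<Sum>k\<in>{i..j}. ?f k)"
    using ij by (intro sum.mono_neutral_right)
      (auto simp: occ_eigvec_mat_index occ_eigvec_inv_mat_index)
  also have "\<dots> = (if i = j then 1 else 0)"
  proof (cases "i \<le> j")
    case True
    let ?n = "m - i" and ?b = "j - i"
    have "(\<Sum>k\<in>{i..j}. ?f k) = (\<Sum>a\<le>?b. ?f (a + i))"
      using True sum.shift_bounds_cl_nat_ivl[of ?f 0 i ?b] by (simp add: atLeast0AtMost)
    also have "\<dots> = (\<Sum>a\<le>?b. (- 1) ^ ?b * real (?n choose ?b) * ((- 1) ^ a * real (?b choose a)))"
    proof (rule sum.cong)
      fix a assume "a \<in> {..?b}"
      then have a: "a \<le> ?b" "a + i \<le> j" using True by auto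
      have "?f (a + i) = (- 1) ^ (?b - a) * (real (?n choose a) * real ((?n - a) choose (?b - a)))"
        using a ij by (simp add: occ_eigvec_mat_index occ_eigvec_inv_mat_index add.commute)
      \<comment> \<open>Trinomial revision: afterwards a occurs in only one binomial coefficient, so
        the other leaves the sum.\<close>
      also have "real (?n choose a) * real ((?n - a) choose (?b - a)) = real (?n choose ?b) * real (?b choose a)"
        using choose_mult[of a ?b ?n] a ij by (simp flip: of_nat_mult)
      \<comment> \<open>The numbers \<open>?b - a\<close> and \<open>?b + a\<close> have the same
        parity.\<close>
      also have "(- 1 :: real) ^ (?b - a) = (- 1) ^ ?b * (- 1) ^ a"
        using a by (simp add: minus_one_power_iff)
      finally show "?f (a + i) = (- 1) ^ ?b * real (?n choose ?b) * ((- 1) ^ a * real (?b choose a))"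
        by simp
    qed simp
    also have "\<dots> = (- 1) ^ ?b * real (?n choose ?b) * (\<Sum>a\<le>?b. (- 1) ^ a * real (?b choose a))"
      by (simp only: sum_distrib_left)
    \<comment> \<open>The alternating sum vanishes for \<open>?b > 0\<close>; \<open>?b = 0\<close>
      means i = j, where every factor is 1.\<close>
    also have "\<dots> = (if i = j then 1 else 0)"
      using True choose_alternating_sum[of ?b, where 'a = real] by auto
    finally show ?thesis .
  qed simp
  finally show "(occ_eigvec_mat m * occ_eigvec_inv_mat m) $$ (i, j) = 1\<^sub>m (m + 1) $$ (i, j)"
    using ij by simp
qed simp_all

text \<open>Absorption, rearranged to compare vertically adjacent entries of v: with n = m - i and
  Suc b = j - i, the two binomials are the entries of column j in rows i and i + 1, and the factor
  on the right is m - j.\<close>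

lemma choose_diff_absorb:
  "real n * (real (n choose Suc b) - real ((n - 1) choose b)) =
    (real n - real (Suc b)) * real (n choose Suc b)"
proof -
  have "real n * real ((n - 1) choose b) = real (Suc b) * real (n choose Suc b)"
    by (metis binomial_absorption of_nat_mult)
  then show ?thesis by (simp add: algebra_simps)
qed

lemma occ_mat_mult_eigvec:
  assumes "m \<ge> 1"
  shows "occ_mat m \<theta> * occ_eigvec_mat m = occ_eigvec_mat m * occ_eigval_mat m \<theta>"
  unfolding occ_eigval_mat_def mat_diag_mult_right[OF occ_carrier(2)]
proof (rule eq_matI)
  fix i j
  assume "i < dim_row (mat (m + 1) (m + 1) (\<lambda>(i, j). occ_eigvec_mat m $$ (i, j) * occ_eigval m \<theta> j))"
    "j < dim_col (mat (m + 1) (m + 1) (\<lambda>(i, j). occ_eigvec_mat m $$ (i, j) * occ_eigval m \<theta> j))"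
  then have ij: "i \<le> m" "j \<le> m" by auto
  let ?V = "\<lambda>i. occ_eigvec_mat m $$ (i, j)"
  let ?c = "\<theta> * (1 - real i / real m)"
  let ?f = "\<lambda>k. occ_mat m \<theta> $$ (i, k) * ?V k"
  have "(occ_mat m \<theta> * occ_eigvec_mat m) $$ (i, j) = (\<Sum>k\<in>{0..<m + 1}. ?f k)"
    using ij by (simp add: scalar_prod_def)
  also have "\<dots> = ?V i * occ_eigval m \<theta> j"
  \<comment> \<open>The last row has no superdiagonal entry; its diagonal entry is 1, and v is zero
    there except at j = m, where the eigenvalue is 1 too.\<close>
  proof (cases "i = m")
    case True
    have "(\<Sum>k\<in>{0..<m + 1}. ?f k) = (\<Sum>k\<in>{i}. ?f k)"
      using ij True by (intro sum.mono_neutral_right) (auto simp: occ_mat_def)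
    also have "\<dots> = ?V i * occ_eigval m \<theta> j"
      using ij True assms by (simp add: occ_mat_def occ_eigval_def occ_eigvec_mat_index)
    finally show ?thesis .
  next
    case False
    then have im: "i < m" using ij by simp
    have "(\<Sum>k\<in>{0..<m + 1}. ?f k) = (\<Sum>k\<in>{i, Suc i}. ?f k)"
      using im by (intro sum.mono_neutral_right) (auto simp: occ_mat_def)
    also have "\<dots> = ?V i - ?c * (?V i - ?V (Suc i))"
      using im by (simp add: occ_mat_def algebra_simps)
    also have "\<dots> = ?V i * occ_eigval m \<theta> j"
    proof -
      \<comment> \<open>The eigenvector equation with \<open>\<theta> / real m\<close> and the
        common term \<open>?V i\<close> stripped off.\<close>
      have key: "real (m - i) * (?V i - ?V (Suc i)) = real (m - j) * ?V i"
      proof (cases "i < j")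
        case True
        then obtain b where b: "j = i + Suc b" using less_imp_add_positive by (metis Suc_pred)
        show ?thesis
          using choose_diff_absorb[of "m - i" b] im ij b
          by (simp add: occ_eigvec_mat_index of_nat_diff algebra_simps)
      next
        case False
        \<comment> \<open>For i = j the entries in rows i and i + 1 are 1 and 0; for i > j both
          vanish.\<close>
        then show ?thesis using im ij by (auto simp: occ_eigvec_mat_index)
      qed
      have "?c = \<theta> / real m * real (m - i)" "1 - real j / real m = real (m - j) / real m"
        using assms ij by (simp_all add: field_simps of_nat_diff)
      then have "?c * (?V i - ?V (Suc i)) = \<theta> / real m * (real (m - j) * ?V i)"
        and "occ_eigval m \<theta> j = 1 - real (m - j) / real m * \<theta>"
        using key by (simp_all add: occ_eigval_def)
      then show ?thesis
        by (simp only:) (simp add: algebra_simps)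
    qed
    finally show ?thesis .
  qed
  finally show "(occ_mat m \<theta> * occ_eigvec_mat m) $$ (i, j) =
      mat (m + 1) (m + 1) (\<lambda>(i, j). occ_eigvec_mat m $$ (i, j) * occ_eigval m \<theta> j) $$ (i, j)"
    using ij by simp
qed simp_all

text \<open>The matrix is upper triangular with the claimed eigenvalues on its diagonal, so they are
  obtained with their multiplicities.\<close>

lemma char_poly_occ_mat:
  "char_poly (occ_mat m \<theta>) = (\<Prod>i = 0..m. [:- occ_eigval m \<theta> i, 1:])"
proof -
  have "upper_triangular (occ_mat m \<theta>)"
    by (auto simp: upper_triangular_def occ_mat_def)
  then have "char_poly (occ_mat m \<theta>) = (\<Prod>a \<leftarrow> diag_mat (occ_mat m \<theta>). [:- a, 1:])"
    by (rule char_poly_upper_triangular[OF occ_carrier(1)])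
  also have "diag_mat (occ_mat m \<theta>) = map (occ_eigval m \<theta>) [0..<m + 1]"
    by (simp add: diag_mat_def occ_mat_def occ_eigval_def mult.commute del: upt_Suc)
  \<comment> \<open>The list of indices is distinct, which turns the list product into one over the
    set \<open>{0..m}\<close>.\<close>
  also have "(\<Prod>a \<leftarrow> map (occ_eigval m \<theta>) [0..<m + 1]. [:- a, 1:]) = (\<Prod>i = 0..m. [:- occ_eigval m \<theta> i, 1:])"
    by (simp add: prod.distinct_set_conv_list[symmetric] comp_def atLeastLessThanSuc_atLeastAtMost del: upt_Suc)
  finally show ?thesis .
qed

theorem theorem2:
  fixes m :: nat and \<theta> :: real
  assumes "m \<ge> 1" and "0 < \<theta>" and "\<theta> \<le> 1"
  shows "{k. eigenvalue (occ_mat m \<theta>) k} = occ_eigval m \<theta> ` {0..m}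
    \<and> char_poly (occ_mat m \<theta>) = (\<Prod>i = 0..m. [:- occ_eigval m \<theta> i, 1:])
    \<and> (\<forall>j\<le>m. eigenvector (occ_mat m \<theta>) (col (occ_eigvec_mat m) j) (occ_eigval m \<theta> j))
    \<and> inverts_mat (occ_eigvec_mat m) (occ_eigvec_inv_mat m)
    \<and> inverts_mat (occ_eigvec_inv_mat m) (occ_eigvec_mat m)
    \<and> lin_indpt_cols (occ_eigvec_mat m)
    \<and> lin_indpt_cols (occ_eigvec_inv_mat m)
    \<and> diagonalisable_mat (occ_mat m \<theta>)
    \<and> occ_mat m \<theta> = occ_eigvec_mat m * occ_eigval_mat m \<theta> * occ_eigvec_inv_mat m"
proof (intro conjI allI impI)
  let ?P = "occ_mat m \<theta>" and ?v = "occ_eigvec_mat m" and ?w = "occ_eigvec_inv_mat m"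
    and ?L = "occ_eigval_mat m \<theta>"
  have vw: "?v * ?w = 1\<^sub>m (m + 1)"
    by (rule occ_eigvec_mat_mult_inv)
  \<comment> \<open>A one-sided inverse of a square matrix is two-sided, which spares a second
    binomial sum.\<close>
  have wv: "?w * ?v = 1\<^sub>m (m + 1)"
    by (rule mat_mult_left_right_inverse[OF occ_carrier(2,3) vw])
  have Pv: "?P * ?v = ?v * ?L"
    using \<open>m \<ge> 1\<close> by (rule occ_mat_mult_eigvec)
  show char: "char_poly ?P = (\<Prod>i = 0..m. [:- occ_eigval m \<theta> i, 1:])"
    by (rule char_poly_occ_mat)
  show "{k. eigenvalue ?P k} = occ_eigval m \<theta> ` {0..m}"
    unfolding eigenvalue_root_char_poly[OF occ_carrier(1)] char by (auto simp: poly_prod)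
  show "eigenvector ?P (col ?v j) (occ_eigval m \<theta> j)" if "j \<le> m" for j
    \<comment> \<open>The diagonal entries of v are \<open>(m - j) choose 0\<close>, hence
      1.\<close>
    using that by (intro eigenvector_col_if_mult_mat_diag[OF occ_carrier(1,2) Pv[unfolded occ_eigval_mat_def]])
      (simp_all add: occ_eigvec_mat_index)
  show "inverts_mat ?v ?w" "inverts_mat ?w ?v"
    using vw wv by (simp_all add: inverts_mat_def)
  show "lin_indpt_cols ?v" "lin_indpt_cols ?w"
    by (rule lin_indpt_cols_if_right_inverse[OF occ_carrier(2,3) vw]
        lin_indpt_cols_if_right_inverse[OF occ_carrier(3,2) wv])+
  show dec: "?P = ?v * ?L * ?w"
    by (rule mult_diag_mult_inverse[OF occ_carrier(1,2,4,3) vw Pv])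
  have "similar_mat ?P ?L"
    by (rule similar_matI[OF _ vw wv dec]) (use occ_carrier in blast)
  moreover have "diagonal_mat ?L"
    by (simp add: occ_eigval_mat_def mat_diag_def diagonal_mat_def)
  ultimately show "diagonalisable_mat ?P"
    unfolding diagonalisable_mat_def by blast
qed

end
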